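(* Let $G=(V,E)$ be a finite simple undirected graph, let $\mathcal{G}=(\mathcal{V},\mathcal{E})$ be a lossless summary of $G$, and let $u,v\in V$ satisfy $S(u)\neq S(v)$, where $S(x)$ denotes the supernode containing $x$. Then the shortest-path distance between $u$ and $v$ in $G$ equals the shortest-path distance between $S(u)$ and $S(v)$ in the graph with vertex set $\mathcal{V}$ and edge set $\{\{X,Y\}\in\mathcal{E}: X\neq Y\}$ (both distances being $\infty$ when no path exists).
   Context: A summary of $G$ is a pair $(\mathcal{V},\mathcal{E})$ where $\mathcal{V}$ is a partition of $V$ into nonempty sets (supernodes) and $\mathcal{E}$ a set of unordered pairs $\{S_i,S_j\}$ of supernodes ($i=j$ allowed, a self-loop), called superedges. Its reconstruction is the simple graph on $V$ containing, for each superedge $\{S_i,S_j\}$ with $i\neq j$, all pairs $\{x,y\}$ with $x\in S_i, y\in S_j$, and for each self-loop $\{S_i,S_i\}$, all pairs of distinct nodes of $S_i$. The summary is lossless if its reconstruction equals $G$. *)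

theory Defs
  imports "Graph_Theory.Graph_Theory" "HOL-Library.Disjoint_Sets"
begin

definition finite_simple_graph :: "'a set \<Rightarrow> 'a set set \<Rightarrow> bool" where
  "finite_simple_graph V E \<longleftrightarrow>
     finite V \<and> E \<subseteq> {{x, y} | x y. x \<in> V \<and> y \<in> V \<and> x \<noteq> y}"

text \<open>Graph_Theory works with digraphs; its undirected graphs (locale pair_graph) carry both
  orientations of every edge.\<close>

definition bidirect :: "'a set \<Rightarrow> 'a set set \<Rightarrow> 'a pair_pre_digraph" where
  "bidirect V E = \<lparr>pverts = V, parcs = {(x, y). {x, y} \<in> E}\<rparr>"

lemma finite_simple_graph_pair_graph:
  assumes "finite_simple_graph V E"
  shows "pair_graph (bidirect V E)"
proof -
  have edge: "x \<in> V \<and> y \<in> V \<and> x \<noteq> y" if "{x, y} \<in> E" for x y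
    using that assms by (fastforce simp: finite_simple_graph_def doubleton_eq_iff)
  have "finite {(x, y). {x, y} \<in> E}"
    by (rule finite_subset[of _ "V \<times> V"])
      (use assms edge in \<open>auto simp: finite_simple_graph_def\<close>)
  moreover have "symmetric (with_proj (bidirect V E))"
    by (auto simp: bidirect_def symmetric_def arcs_ends_def arc_to_ends_def sym_def
        insert_commute)
  ultimately show ?thesis
    using assms edge
    by unfold_locales (auto simp: bidirect_def finite_simple_graph_def)
qed

text \<open>The library's distance \<open>\<mu>\<close> is the infimum of the costs of all walks between two vertices;
  with unit arc costs this is the length of a shortest path, and it is \<open>\<infinity>\<close> if there is none.\<close>

definition graph_dist :: "'a set \<Rightarrow> 'a set set \<Rightarrow> 'a \<Rightarrow> 'a \<Rightarrow> ereal" where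
  "graph_dist V E = wf_digraph.\<mu> (with_proj (bidirect V E)) (\<lambda>_. 1)"

lemma graph_dist_eq:
  assumes "finite_simple_graph V E"
  shows "graph_dist V E u v =
    (INF p \<in> {p. pre_digraph.awalk (with_proj (bidirect V E)) u p v}. ereal (real (length p)))"
proof -
  interpret pair_graph "bidirect V E"
    using assms by (rule finite_simple_graph_pair_graph)
  have "awalk_cost (\<lambda>_. 1) p = real (length p)" for p :: "('a \<times> 'a) list"
    by (induction p) auto
  then show ?thesis
    by (simp add: graph_dist_def \<mu>_def)
qed

text \<open>The superedge \<open>{X, Y}\<close> with \<open>X = Y\<close>, a self-loop, is the singleton \<open>{X}\<close>.\<close>

definition is_summary :: "'a set \<Rightarrow> 'a set set \<Rightarrow> 'a set set set \<Rightarrow> bool" where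
  "is_summary V \<V> \<E> \<longleftrightarrow>
     partition_on V \<V> \<and> \<E> \<subseteq> {{X, Y} | X Y. X \<in> \<V> \<and> Y \<in> \<V>}"

definition reconstruction_edges :: "'a set set set \<Rightarrow> 'a set set" where
  "reconstruction_edges \<E> =
     {{x, y} | x y. \<exists>X Y. {X, Y} \<in> \<E> \<and> X \<noteq> Y \<and> x \<in> X \<and> y \<in> Y} \<union>
     {{x, y} | x y. \<exists>X. {X, X} \<in> \<E> \<and> x \<in> X \<and> y \<in> X \<and> x \<noteq> y}"

text \<open>A summary of \<open>(V, E)\<close> reconstructs to a graph on the same vertex set \<open>V\<close>, so only the edge
  sets have to be compared.\<close>

definition lossless_summary ::
    "'a set \<Rightarrow> 'a set set \<Rightarrow> 'a set set \<Rightarrow> 'a set set set \<Rightarrow> bool" where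
  "lossless_summary V E \<V> \<E> \<longleftrightarrow> is_summary V \<V> \<E> \<and> reconstruction_edges \<E> = E"

definition supernode :: "'a set set \<Rightarrow> 'a \<Rightarrow> 'a set" where
  "supernode \<V> x = (THE X. X \<in> \<V> \<and> x \<in> X)"

lemma supernode_unique:
  assumes "partition_on V \<V>" "x \<in> V"
  shows "\<exists>!X. X \<in> \<V> \<and> x \<in> X"
  using assms by (fastforce simp: partition_on_def disjoint_def)

definition proper_superedges :: "'a set set set \<Rightarrow> 'a set set set" where
  "proper_superedges \<E> = {{X, Y} | X Y. {X, Y} \<in> \<E> \<and> X \<noteq> Y}"

lemma summary_finite_simple_graph:
  assumes "finite V" "is_summary V \<V> \<E>"
  shows "finite_simple_graph \<V> (proper_superedges \<E>)"
proof -
  have "\<Union>\<V> = V"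
    using assms(2) by (simp add: is_summary_def partition_on_def)
  then have "finite \<V>"
    using assms(1) finite_UnionD by blast
  moreover have "X \<in> \<V> \<and> Y \<in> \<V>" if "{X, Y} \<in> \<E>" for X Y
    using that assms(2) by (fastforce simp: is_summary_def doubleton_eq_iff)
  ultimately show ?thesis
    by (fastforce simp: finite_simple_graph_def proper_superedges_def)
qed

end

theory Submission
  imports Defs
begin

text \<open>A walk in \<open>G\<close> projects to a walk of supernodes once the steps inside a supernode are dropped,
  so it does not get longer. Conversely a nonempty walk of supernodes lifts to a walk of the same
  length between any chosen nodes of its end supernodes, because a superedge between distinct
  supernodes joins all their nodes. Nonemptiness is what \<open>S(u) \<noteq> S(v)\<close> is needed for.\<close>

text \<open>This and the next fact restate the recursion of \<open>awalk\<close> outside the locale,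
  because walks in \<open>G\<close> and walks of supernodes later occur side by side in one
  induction.\<close>

lemma awalk_bidirect_Nil_iff:
  assumes "finite_simple_graph V E"
  shows "pre_digraph.awalk (with_proj (bidirect V E)) u [] v \<longleftrightarrow> u = v \<and> u \<in> V"
proof -
  interpret pair_graph "bidirect V E"
    using assms by (rule finite_simple_graph_pair_graph)
  show ?thesis
    unfolding awalk_Nil_iff by (auto simp: bidirect_def)
qed

lemma awalk_bidirect_Cons_iff:
  assumes "finite_simple_graph V E"
  shows "pre_digraph.awalk (with_proj (bidirect V E)) u (e # p) v \<longleftrightarrow>
    {u, snd e} \<in> E \<and> fst e = u \<and> pre_digraph.awalk (with_proj (bidirect V E)) (snd e) p v"
proof -
  interpret pair_graph "bidirect V E"
    using assms by (rule finite_simple_graph_pair_graph)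
  show ?thesis
    unfolding awalk_Cons_iff by (auto simp: bidirect_def)
qed

lemma finite_simple_graph_edgeD:
  assumes "finite_simple_graph V E" "{x, y} \<in> E"
  shows "x \<in> V" "y \<in> V"
proof -
  \<comment> \<open>Viewing an edge as a subset of \<open>V\<close> avoids distinguishing the two
    orders of its endpoints.\<close>
  have "E \<subseteq> Pow V"
    using assms(1) unfolding finite_simple_graph_def by (elim conjE order_trans) auto
  from subsetD[OF this assms(2)] show "x \<in> V" "y \<in> V"
    by simp_all
qed

lemma supernode_eq:
  assumes "partition_on V \<V>" "X \<in> \<V>" "x \<in> X"
  shows "supernode \<V> x = X"
proof -
  have "x \<in> V"
    using assms unfolding partition_on_def by blast
  from the1_equality[OF supernode_unique[OF assms(1) this]] assms(2,3) show ?thesis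
    unfolding supernode_def by blast
qed

lemma supernode_mem:
  assumes "partition_on V \<V>" "x \<in> V"
  shows "supernode \<V> x \<in> \<V>" "x \<in> supernode \<V> x"
  using theI'[OF supernode_unique[OF assms]] by (simp_all add: supernode_def)

lemma superedgeD:
  assumes "is_summary V \<V> \<E>" "{X, Y} \<in> \<E>"
  shows "X \<in> \<V>" "Y \<in> \<V>"
proof -
  have "\<E> \<subseteq> Pow \<V>"
    using assms(1) unfolding is_summary_def by (elim conjE order_trans) auto
  from subsetD[OF this assms(2)] show "X \<in> \<V>" "Y \<in> \<V>"
    by simp_all
qed

text \<open>Every edge of \<open>G\<close> is reconstructed from some superedge. A self-loop only
  yields pairs inside one supernode, so here the superedge has distinct ends, and these are the
  supernodes of the two endpoints.\<close>

lemma lossless_edge_supernodes: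
  assumes "lossless_summary V E \<V> \<E>" "{x, y} \<in> E" "supernode \<V> x \<noteq> supernode \<V> y"
  shows "{supernode \<V> x, supernode \<V> y} \<in> proper_superedges \<E>"
proof -
  have summ: "is_summary V \<V> \<E>" and "{x, y} \<in> reconstruction_edges \<E>"
    using assms by (auto simp: lossless_summary_def)
  have part: "partition_on V \<V>"
    using summ by (simp add: is_summary_def)
  have super: "supernode \<V> z = Z" if "{Z, W} \<in> \<E>" "z \<in> Z" for z Z W
    using supernode_eq[OF part superedgeD(1)[OF summ that(1)] that(2)] .
  have super': "supernode \<V> z = Z" if "{W, Z} \<in> \<E>" "z \<in> Z" for z Z W
    using supernode_eq[OF part superedgeD(2)[OF summ that(1)] that(2)] .
  from \<open>{x, y} \<in> reconstruction_edges \<E>\<close> consider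
    (cross) a b X Y where "{x, y} = {a, b}" "{X, Y} \<in> \<E>" "X \<noteq> Y" "a \<in> X" "b \<in> Y"
    | (loop) a b X where "{x, y} = {a, b}" "{X, X} \<in> \<E>" "a \<in> X" "b \<in> X"
    unfolding reconstruction_edges_def by blast
  then show ?thesis
  proof cases
    case cross
    \<comment> \<open>Whether \<open>x\<close> is \<open>a\<close> or \<open>b\<close> stays open;
      taking the image of the unordered pair treats both cases at once.\<close>
    have "{supernode \<V> x, supernode \<V> y} = supernode \<V> ` {x, y}"
      by simp
    also have "\<dots> = {X, Y}"
      using super[OF cross(2,4)] super'[OF cross(2,5)] by (simp add: cross(1))
    finally show ?thesis
      using cross(2,3) unfolding proper_superedges_def by auto
  next
    case loop
    then have "x \<in> X" "y \<in> X"
      by (auto simp: doubleton_eq_iff)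
    then have "supernode \<V> x = X" "supernode \<V> y = X"
      using super[OF loop(2)] by simp_all
    with assms(3) show ?thesis by simp
  qed
qed

lemma lossless_proper_superedge_edges:
  assumes "lossless_summary V E \<V> \<E>" "{X, Y} \<in> proper_superedges \<E>" "x \<in> X" "y \<in> Y"
  shows "{x, y} \<in> E"
proof -
  have "{X, Y} \<in> \<E>" "X \<noteq> Y"
    using assms(2) by (auto simp: proper_superedges_def doubleton_eq_iff insert_commute)
  with assms(3,4) have "{x, y} \<in> reconstruction_edges \<E>"
    unfolding reconstruction_edges_def by blast
  with assms(1) show ?thesis
    by (simp add: lossless_summary_def)
qed

text \<open>Gives the inequality that the distance between supernodes is at most the distance in
  \<open>G\<close>.\<close>

lemma awalk_project:
  assumes G: "finite_simple_graph V E" and lossless: "lossless_summary V E \<V> \<E>"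
    and H: "finite_simple_graph \<V> (proper_superedges \<E>)"
    and "pre_digraph.awalk (with_proj (bidirect V E)) u p v"
  shows "\<exists>q. pre_digraph.awalk (with_proj (bidirect \<V> (proper_superedges \<E>)))
      (supernode \<V> u) q (supernode \<V> v) \<and> length q \<le> length p"
  using assms(4)
proof (induction p arbitrary: u)
  case Nil
  have "partition_on V \<V>"
    using lossless by (simp add: lossless_summary_def is_summary_def)
  with Nil show ?case
    by (auto simp: awalk_bidirect_Nil_iff[OF G] awalk_bidirect_Nil_iff[OF H] supernode_mem)
next
  case (Cons e p)
  then have edge: "{u, snd e} \<in> E"
    and walk: "pre_digraph.awalk (with_proj (bidirect V E)) (snd e) p v"
    by (simp_all add: awalk_bidirect_Cons_iff[OF G])
  obtain q where q: "pre_digraph.awalk (with_proj (bidirect \<V> (proper_superedges \<E>)))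
      (supernode \<V> (snd e)) q (supernode \<V> v)" "length q \<le> length p"
    using Cons.IH[OF walk] by blast
  show ?case
  proof (cases "supernode \<V> u = supernode \<V> (snd e)")
    case True
    \<comment> \<open>The step stays inside one supernode, so the projection of the remaining walk
      already starts at the right place.\<close>
    with q show ?thesis by (intro exI[of _ q]) simp
  next
    case False
    then show ?thesis
      using q lossless_edge_supernodes[OF lossless edge]
      by (intro exI[of _ "(supernode \<V> u, supernode \<V> (snd e)) # q"])
        (simp add: awalk_bidirect_Cons_iff[OF H])
  qed
qed

text \<open>Gives the reverse inequality. The start \<open>x\<close> is arbitrary in the induction
  because it moves to a freely chosen node of the next supernode, while the target \<open>y\<close>
  stays fixed. For an empty walk \<open>X = Y\<close>, but \<open>x\<close> and \<open>y\<close>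
  could still differ.\<close>

lemma awalk_lift:
  assumes G: "finite_simple_graph V E" and lossless: "lossless_summary V E \<V> \<E>"
    and H: "finite_simple_graph \<V> (proper_superedges \<E>)"
    and "pre_digraph.awalk (with_proj (bidirect \<V> (proper_superedges \<E>))) X q Y"
    and "q \<noteq> []" "x \<in> X" "y \<in> Y"
  shows "\<exists>p. pre_digraph.awalk (with_proj (bidirect V E)) x p y \<and> length p = length q"
  using assms(4-6)
proof (induction q arbitrary: X x)
  case Nil
  then show ?case by simp
next
  case (Cons e q)
  then have edge: "{X, snd e} \<in> proper_superedges \<E>"
    and walk: "pre_digraph.awalk (with_proj (bidirect \<V> (proper_superedges \<E>))) (snd e) q Y"
    by (simp_all add: awalk_bidirect_Cons_iff[OF H])
  have step: "{x, z} \<in> E" if "z \<in> snd e" for z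
    using lossless_proper_superedge_edges[OF lossless edge \<open>x \<in> X\<close> that] .
  show ?case
  \<comment> \<open>The last superedge has to end at the prescribed \<open>y\<close>; all earlier
    ones may end at any node of the next supernode.\<close>
  proof (cases "q = []")
    case True
    with walk have "snd e = Y"
      by (simp add: awalk_bidirect_Nil_iff[OF H])
    with step \<open>y \<in> Y\<close> have "{x, y} \<in> E" by simp
    with True show ?thesis
      by (intro exI[of _ "[(x, y)]"])
        (simp add: awalk_bidirect_Cons_iff[OF G] awalk_bidirect_Nil_iff[OF G]
          finite_simple_graph_edgeD[OF G])
  next
    case False
    \<comment> \<open>Blocks of a partition are nonempty, so the next supernode offers a node
      \<open>z\<close> to pass through.\<close>
    have "{} \<notin> \<V>"
      using lossless by (simp add: lossless_summary_def is_summary_def partition_on_def)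
    then obtain z where z: "z \<in> snd e"
      using finite_simple_graph_edgeD(2)[OF H edge] by fastforce
    obtain p where "pre_digraph.awalk (with_proj (bidirect V E)) z p y" "length p = length q"
      using Cons.IH[OF walk False z] by blast
    with step[OF z] show ?thesis
      by (intro exI[of _ "(x, z) # p"]) (simp add: awalk_bidirect_Cons_iff[OF G])
  qed
qed

theorem theorem3p7:
  fixes V :: "'a set" and E :: "'a set set"
    and \<V> :: "'a set set" and \<E> :: "'a set set set"
    and u v :: 'a
  assumes "finite_simple_graph V E"
    and "lossless_summary V E \<V> \<E>"
    and "u \<in> V" and "v \<in> V"
    and "supernode \<V> u \<noteq> supernode \<V> v"
  shows "graph_dist V E u v =
    graph_dist \<V> (proper_superedges \<E>) (supernode \<V> u) (supernode \<V> v)"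
proof -
  have summ: "is_summary V \<V> \<E>" and part: "partition_on V \<V>"
    using assms(2) by (simp_all add: lossless_summary_def is_summary_def)
  have H: "finite_simple_graph \<V> (proper_superedges \<E>)"
    using assms(1) summ by (intro summary_finite_simple_graph) (simp_all add: finite_simple_graph_def)
  show ?thesis
    unfolding graph_dist_eq[OF assms(1)] graph_dist_eq[OF H]
  \<comment> \<open>It suffices that each walk on either side is matched by one on the other side
    that is no longer. This includes the value \<infinity>: if one set of walks is empty, so is the
    other.\<close>
  proof (rule INF_eq)
    fix p assume "p \<in> {p. pre_digraph.awalk (with_proj (bidirect V E)) u p v}"
    then show "\<exists>q \<in> {q. pre_digraph.awalk (with_proj (bidirect \<V> (proper_superedges \<E>)))
        (supernode \<V> u) q (supernode \<V> v)}. ereal (real (length q)) \<le> ereal (real (length p))"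
      using awalk_project[OF assms(1,2) H] by fastforce
  next
    fix q assume "q \<in> {q. pre_digraph.awalk (with_proj (bidirect \<V> (proper_superedges \<E>)))
        (supernode \<V> u) q (supernode \<V> v)}"
    then have walk: "pre_digraph.awalk (with_proj (bidirect \<V> (proper_superedges \<E>)))
        (supernode \<V> u) q (supernode \<V> v)"
      by simp
    then have "q \<noteq> []"
      using assms(5) by (auto simp: awalk_bidirect_Nil_iff[OF H])
    with walk obtain p where
      "pre_digraph.awalk (with_proj (bidirect V E)) u p v" "length p = length q"
      using awalk_lift[OF assms(1,2) H] supernode_mem(2)[OF part] assms(3,4) by metis
    then show "\<exists>p \<in> {p. pre_digraph.awalk (with_proj (bidirect V E)) u p v}.
        ereal (real (length p)) \<le> ereal (real (length q))"
      by (intro bexI[of _ p]) simp_all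
  qed
qed

end
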